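(* Let $m$ be a positive integer with $m\equiv 2\bmod 4$. There exists a Steiner triple system on $n=6m+1$ points with a cyclic $(n+3)/4$-good sequencing.
   Context: A Steiner triple system on $n$ points is a set $V$ with $|V|=n$ together with a set of $3$-subsets of $V$, called blocks, such that every pair of distinct points is contained in a unique block. A sequencing of $V$ is a sequence $x_1,\ldots,x_n$ in which every element of $V$ occurs exactly once. The cyclic segments of $x_1,\ldots,x_n$ are its subsequences of consecutive entries together with the sequences $x_a,x_{a+1},\ldots,x_n,x_1,\ldots,x_b$ for $1\leq b<a\leq n$. A sequencing is cyclic $\ell$-good if no cyclic segment of length at most $\ell$ contains all the points of a block. *)

theory Defs
  imports "HOL-Library.Sublist" "HOL-Number_Theory.Cong"
begin

definition steiner_triple_system :: "nat \<Rightarrow> 'a set \<Rightarrow> 'a set set \<Rightarrow> bool" where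
  "steiner_triple_system n V B \<longleftrightarrow>
     finite V \<and> card V = n \<and>
     (\<forall>b\<in>B. b \<subseteq> V \<and> card b = 3) \<and>
     (\<forall>x\<in>V. \<forall>y\<in>V. x \<noteq> y \<longrightarrow> (\<exists>!b. b \<in> B \<and> x \<in> b \<and> y \<in> b))"

definition sequencing :: "'a set \<Rightarrow> 'a list \<Rightarrow> bool" where
  "sequencing V xs \<longleftrightarrow> distinct xs \<and> set xs = V"

text \<open>The indices \<open>a\<close>, \<open>b\<close> are 1-based: \<open>drop (a - 1) xs\<close> is the sequence of the
  \<open>a\<close>-th up to the last entry, \<open>take b xs\<close> that of the first up to the \<open>b\<close>-th entry.
  A \<open>sublist\<close> is contiguous; the empty list is included, which is harmless below.\<close>

definition cyclic_segments :: "'a list \<Rightarrow> 'a list set" where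
  "cyclic_segments xs =
     {ys. sublist ys xs} \<union>
     {drop (a - 1) xs @ take b xs | a b. 1 \<le> b \<and> b < a \<and> a \<le> length xs}"

definition cyclic_good :: "nat \<Rightarrow> 'a set set \<Rightarrow> 'a list \<Rightarrow> bool" where
  "cyclic_good l B xs \<longleftrightarrow>
     (\<forall>s\<in>cyclic_segments xs. length s \<le> l \<longrightarrow> \<not> (\<exists>b\<in>B. b \<subseteq> set s))"

end

theory Submission imports Defs begin

text \<open>
  The Steiner triple system is cyclic: its points are the residues modulo \<open>n\<close>, and its blocks are
  the translates of \<open>m\<close> base triples whose differences cover every nonzero residue. The
  sequencing is the natural order \<open>0, 1, \<dots>, n - 1\<close>. The cyclic segments of length at most \<open>l\<close>
  then lie in windows of \<open>l\<close> consecutive residues, so a block is spread too widely as soon as it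
  contains two points whose difference lies between \<open>l\<close> and \<open>n - l\<close>
  (\<open>window_avoids_long_difference\<close>). Hence it is enough that each base triple has one such
  difference.

  The base triples come from a hooked Skolem sequence of order \<open>m = 4 * s + 2\<close>, that is, from a
  partition of \<open>{1..2 * m - 1} \<union> {2 * m + 1}\<close> into pairs \<open>(a\<^sub>r, b\<^sub>r)\<close> with \<open>b\<^sub>r - a\<^sub>r = r\<close> for
  \<open>1 \<le> r \<le> m\<close>. The triple \<open>{0, a\<^sub>r + m, b\<^sub>r + m}\<close> has the differences \<open>r\<close>, \<open>a\<^sub>r + m\<close>,
  \<open>b\<^sub>r + m\<close> up to sign; over all \<open>r\<close> they are \<open>1, \<dots>, 3 * m - 1\<close> and \<open>3 * m + 1\<close>, and the last one
  is \<open>- (3 * m)\<close> modulo \<open>6 * m + 1\<close>.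

  The sequence used here (in the style of O'Keefe) begins with the nested pairs \<open>(i, m - i)\<close>
  for \<open>1 \<le> i < m div 2\<close>, and the position \<open>m div 2\<close> between them is a left end too. Therefore its
  smallest right end is \<open>m div 2 + 1\<close>, and each difference \<open>b\<^sub>r + m\<close> is at least
  \<open>(3 * m + 2) div 2\<close>. This is exactly \<open>l = (n + 3) div 4\<close>; and \<open>n - l\<close> is above the largest
  difference \<open>3 * m + 1\<close>.
\<close>

section \<open>Cyclic Steiner triple systems from difference families\<close>

definition translate :: "nat \<Rightarrow> (nat \<Rightarrow> int) \<Rightarrow> int \<Rightarrow> nat set" where
  "translate n f z = (\<lambda>j. nat ((z + f j) mod int n)) ` {..<3}"

lemma translate_mod_cong:
  assumes "z mod int n = z' mod int n"
  shows "translate n f z = translate n f z'"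
  using assms unfolding translate_def by (metis mod_add_left_eq)

text \<open>
  The \<open>card I\<close> base triples have \<open>6 * card I\<close> ordered differences, as many as there are nonzero
  residues, so a covering is automatically a bijection: no nonzero residue is a difference twice,
  and zero never is. The former gives the uniqueness of the block through two points, the latter
  that the three points of a translate are distinct.
\<close>

lemma steiner_triple_system_of_difference_cover:
  fixes off :: "'i \<Rightarrow> nat \<Rightarrow> int"
  assumes fin: "finite I" and n: "n = 6 * card I + 1"
    and cover: "\<And>d. d \<in> {1..<int n} \<Longrightarrow>
      \<exists>i\<in>I. \<exists>j<3. \<exists>k<3. j \<noteq> k \<and> (off i k - off i j) mod int n = d"
  shows "steiner_triple_system n {..<n} {translate n (off i) z | i z. i \<in> I}"
proof -
  define S where "S = {(j, k). j < (3::nat) \<and> k < (3::nat) \<and> j \<noteq> k}"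
  define F where "F = (\<lambda>(i, j, k). (off i k - off i j) mod int n)"
  have S: "S = {(0,1),(0,2),(1,0),(1,2),(2,0),(2,1)}"
    unfolding S_def by auto
  have finT: "finite (I \<times> S)" using fin S by simp
  have cardT: "card (I \<times> S) = 6 * card I"
    by (simp add: card_cartesian_product S)
  have sup: "{1..<int n} \<subseteq> F ` (I \<times> S)"
  proof
    fix d assume "d \<in> {1..<int n}"
    from cover[OF this] obtain i j k where "i \<in> I" "j < 3" "k < 3" "j \<noteq> k"
      "(off i k - off i j) mod int n = d" by blast
    then have "(i, j, k) \<in> I \<times> S" "F (i, j, k) = d" by (auto simp: S_def F_def)
    then show "d \<in> F ` (I \<times> S)" by blast
  qed
  have le: "card (F ` (I \<times> S)) \<le> card {1..<int n}"
    using card_image_le[OF finT, of F] cardT n by simp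
  have img: "F ` (I \<times> S) = {1..<int n}"
    using card_seteq[OF _ sup le] finT by simp
  have inj: "inj_on F (I \<times> S)"
    by (rule eq_card_imp_inj_on[OF finT]) (simp add: img cardT n)
  have nz: "(off i k - off i j) mod int n \<noteq> 0" if "i \<in> I" "j < 3" "k < 3" "j \<noteq> k" for i j k
  proof -
    have "F (i, j, k) \<in> F ` (I \<times> S)" using that by (intro imageI) (auto simp: S_def)
    then show ?thesis unfolding img by (auto simp: F_def)
  qed
  have npos: "int n > 0" using n by simp
  have card3: "card (translate n (off i) z) = 3" if "i \<in> I" for i z
  proof -
    have "inj_on (\<lambda>j. nat ((z + off i j) mod int n)) {..<3}"
    proof (rule inj_onI, rule ccontr)
      fix j k :: nat
      assume jk: "j \<in> {..<3}" "k \<in> {..<3}" "j \<noteq> k"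
        and eq: "nat ((z + off i j) mod int n) = nat ((z + off i k) mod int n)"
      from eq have "(z + off i k) mod int n = (z + off i j) mod int n"
        using npos by (simp add: nat_eq_iff)
      then have "(off i k - off i j) mod int n = 0"
        by (simp add: mod_eq_dvd_iff)
      with nz[OF that] jk show False by simp
    qed
    then show ?thesis unfolding translate_def by (simp add: card_image)
  qed
  have sub: "translate n f z \<subseteq> {..<n}" for f z
    using npos unfolding translate_def by (auto simp: nat_less_iff)
  have uniq: "\<exists>!b. b \<in> {translate n (off i) z | i z. i \<in> I} \<and> x \<in> b \<and> y \<in> b"
    if xy: "x < n" "y < n" "x \<noteq> y" for x y
  proof -
    define d where "d = (int y - int x) mod int n"
    have "d \<noteq> 0"
    proof
      assume "d = 0"
      then have "int y mod int n = int x mod int n"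
        unfolding d_def by (simp add: mod_eq_dvd_iff mod_eq_0_iff_dvd)
      then show False using xy by simp
    qed
    moreover have "0 \<le> d" "d < int n" unfolding d_def using npos by simp_all
    ultimately have d: "d \<in> {1..<int n}" by simp
    then obtain i j k where ijk: "i \<in> I" "j < 3" "k < 3"
      "(off i k - off i j) mod int n = d" using cover by blast
    define z where "z = int x - off i j"
    have "x = nat ((z + off i j) mod int n)" using xy by (simp add: z_def)
    then have xin: "x \<in> translate n (off i) z"
      unfolding translate_def using ijk by blast
    have "(z + off i k) mod int n = (int x + (off i k - off i j)) mod int n"
      by (simp add: z_def algebra_simps)
    also have "\<dots> = (int x + (int y - int x)) mod int n"
      using ijk(4) unfolding d_def by (metis mod_add_right_eq)
    finally have "y = nat ((z + off i k) mod int n)" using xy by simp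
    then have yin: "y \<in> translate n (off i) z"
      unfolding translate_def using ijk by blast
    have locate: "\<exists>j k. (i, j, k) \<in> I \<times> S \<and> F (i, j, k) = d \<and> (z + off i j) mod int n = int x"
      if i: "i \<in> I" and mem: "x \<in> translate n (off i) z" "y \<in> translate n (off i) z" for i z
    proof -
      from mem obtain j k where jk: "j < 3" "k < 3"
        and x: "x = nat ((z + off i j) mod int n)" and y: "y = nat ((z + off i k) mod int n)"
        unfolding translate_def by blast
      have x': "(z + off i j) mod int n = int x" and y': "(z + off i k) mod int n = int y"
        using x y npos by auto
      have "d = ((z + off i k) - (z + off i j)) mod int n"
        unfolding d_def x'[symmetric] y'[symmetric] by (simp only: mod_diff_eq)
      then have "F (i, j, k) = d" by (simp add: F_def)
      moreover have "j \<noteq> k" using x y xy by auto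
      ultimately show ?thesis using jk i x' by (auto simp: S_def)
    qed
    have "b = translate n (off i) z"
      if b: "b \<in> {translate n (off i) z | i z. i \<in> I}" "x \<in> b" "y \<in> b" for b
    proof -
      from b obtain i' z' where i': "i' \<in> I" and b': "b = translate n (off i') z'" by blast
      obtain j\<^sub>1 k\<^sub>1 where 1: "(i, j\<^sub>1, k\<^sub>1) \<in> I \<times> S" "F (i, j\<^sub>1, k\<^sub>1) = d"
        "(z + off i j\<^sub>1) mod int n = int x"
        using locate[OF ijk(1) xin yin] by blast
      obtain j\<^sub>2 k\<^sub>2 where 2: "(i', j\<^sub>2, k\<^sub>2) \<in> I \<times> S" "F (i', j\<^sub>2, k\<^sub>2) = d"
        "(z' + off i' j\<^sub>2) mod int n = int x"
        using locate[OF i'] b b' by blast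
      have "(i, j\<^sub>1, k\<^sub>1) = (i', j\<^sub>2, k\<^sub>2)"
        using inj_onD[OF inj _ 1(1) 2(1)] 1(2) 2(2) by simp
      then have "i = i'" and "j\<^sub>1 = j\<^sub>2" by auto
      then have "z mod int n = z' mod int n"
        using 1(3) 2(3) by (metis add_diff_cancel_right' mod_diff_left_eq)
      then show ?thesis using b' \<open>i = i'\<close> translate_mod_cong by metis
    qed
    then show ?thesis using xin yin ijk(1) by blast
  qed
  show ?thesis
    unfolding steiner_triple_system_def using sub card3 uniq by auto
qed

section \<open>Segments of the natural order of the residues\<close>

lemma cyclic_segment_upt_subset_window:
  assumes s: "s \<in> cyclic_segments [0..<n]"
  obtains w where "set s \<subseteq> (\<lambda>i. (w + i) mod n) ` {..<length s}"
proof -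
  from s consider (inner) "sublist s [0..<n]"
    | (wrapped) a b where "s = drop (a - 1) [0..<n] @ take b [0..<n]" "1 \<le> b" "b < a" "a \<le> n"
    unfolding cyclic_segments_def by auto
  then show thesis
  proof cases
    case inner
    then obtain ps ss where eq: "[0..<n] = ps @ s @ ss" by (auto simp: sublist_def)
    have "s ! i = (length ps + i) mod n" if "i < length s" for i
    proof -
      have lt: "length ps + i < n" using that arg_cong[OF eq, of length] by simp
      have "s ! i = [0..<n] ! (length ps + i)" using that by (simp add: eq nth_append)
      then show ?thesis using lt by simp
    qed
    then have "set s \<subseteq> (\<lambda>i. (length ps + i) mod n) ` {..<length s}"
      by (auto simp: set_conv_nth)
    then show thesis by (rule that)
  next
    case wrapped
    have s': "s = [a - 1..<n] @ [0..<b]"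
      using wrapped by (simp add: take_upt)
    have "v \<in> (\<lambda>i. (a - 1 + i) mod n) ` {..<length s}" if "v \<in> set s" for v
    proof (cases "v < b")
      case True
      then have "v = (a - 1 + (n - (a - 1) + v)) mod n" using wrapped by simp
      moreover have "n - (a - 1) + v < length s" using True wrapped unfolding s' by simp
      ultimately show ?thesis by blast
    next
      case False
      then have v: "a - 1 \<le> v" "v < n" using that unfolding s' by auto
      then have "v = (a - 1 + (v - (a - 1))) mod n" by simp
      moreover have "v - (a - 1) < length s" using v unfolding s' by simp
      ultimately show ?thesis by blast
    qed
    then show thesis by (intro that) blast
  qed
qed

text \<open>
  Two residues in a window of length \<open>l\<close> differ by an integer of absolute value less than \<open>l\<close>.
  If this integer is \<open>\<delta>\<close> modulo \<open>n\<close> with \<open>0 < \<delta> < n\<close>, then it is at least \<open>\<delta>\<close> or at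
  most \<open>\<delta> - n\<close>.
\<close>

lemma window_avoids_long_difference:
  fixes z \<delta> :: int
  assumes \<delta>: "int l \<le> \<delta>" "\<delta> \<le> int n - int l"
    and x: "nat (z mod int n) \<in> (\<lambda>i. (w + i) mod n) ` {..<l}"
    and y: "nat ((z + \<delta>) mod int n) \<in> (\<lambda>i. (w + i) mod n) ` {..<l}"
  shows False
proof -
  from x y obtain i j where ij: "i < l" "j < l"
    and i: "nat (z mod int n) = (w + i) mod n" and j: "nat ((z + \<delta>) mod int n) = (w + j) mod n"
    by auto
  have npos: "int n > 0" using \<delta> ij by linarith
  have i': "z mod int n = (int w + int i) mod int n"
    using arg_cong[OF i, of int] npos by (simp add: zmod_int)
  have j': "(z + \<delta>) mod int n = (int w + int j) mod int n"
    using arg_cong[OF j, of int] npos by (simp add: zmod_int)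
  have "(z + \<delta> - z) mod int n = (int w + int j - (int w + int i)) mod int n"
    using i' j' by (metis mod_diff_eq)
  then have dvd: "int n dvd \<delta> - (int j - int i)"
    by (simp add: mod_eq_dvd_iff)
  have "0 < \<delta> - (int j - int i)" "\<delta> - (int j - int i) < int n"
    using \<delta> ij by linarith+
  with dvd show False using zdvd_not_zless by blast
qed

lemma cyclic_good_translates:
  fixes off :: "'i \<Rightarrow> nat \<Rightarrow> int"
  assumes long: "\<And>i. i \<in> I \<Longrightarrow> \<exists>j<3. \<exists>k<3. off i k - off i j \<in> {int l..int n - int l}"
  shows "cyclic_good l {translate n (off i) z | i z. i \<in> I} [0..<n]"
  unfolding cyclic_good_def
proof (intro ballI impI notI)
  fix s assume s: "s \<in> cyclic_segments [0..<n]" and len: "length s \<le> l"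
    and "\<exists>b\<in>{translate n (off i) z | i z. i \<in> I}. b \<subseteq> set s"
  then obtain i z where i: "i \<in> I" and sub: "translate n (off i) z \<subseteq> set s" by blast
  obtain w where "set s \<subseteq> (\<lambda>i. (w + i) mod n) ` {..<length s}"
    using cyclic_segment_upt_subset_window[OF s] .
  also have "\<dots> \<subseteq> (\<lambda>i. (w + i) mod n) ` {..<l}" using len by auto
  finally have win: "translate n (off i) z \<subseteq> (\<lambda>i. (w + i) mod n) ` {..<l}" using sub by blast
  obtain j k where jk: "j < 3" "k < 3" "off i k - off i j \<in> {int l..int n - int l}"
    using long[OF i] by blast
  have pt: "nat ((z + off i j) mod int n) \<in> (\<lambda>i. (w + i) mod n) ` {..<l}" if "j < 3" for j
    using win that unfolding translate_def by blast
  show False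
    using window_avoids_long_difference[of l "off i k - off i j" n "z + off i j" w]
      jk pt[OF jk(1)] pt[OF jk(2)] by simp
qed

section \<open>A hooked Skolem sequence whose right ends are large\<close>

text \<open>
  The left end of the pair with difference \<open>r\<close> in the sequence of order \<open>4 * s + 2\<close>. The largest
  \<open>r\<close> belongs to the pair \<open>(4 * s + 3, 8 * s + 5)\<close>, which ends at the hook. The other even \<open>r\<close> come
  from the nested pairs \<open>(i, 4 * s + 2 - i)\<close>. For \<open>r = 4 * s + 1, 2 * s + 1, 1\<close> there are single
  pairs that fill the gaps between the nested families, and the other odd \<open>r\<close> come from the nested pairs
  \<open>(4 * s + 3 + i, 8 * s + 4 - i)\<close> for \<open>r > 2 * s + 1\<close> and \<open>(5 * s + 2 + i, 7 * s + 3 - i)\<close>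
  for \<open>r < 2 * s + 1\<close>. For \<open>s = 0\<close> the conditions of these single pairs coincide; the one
  for \<open>r = 4 * s + 1\<close> has to be tested first and yields the sequence \<open>(1, 2), (3, 5)\<close>.
\<close>

definition left_end :: "nat \<Rightarrow> nat \<Rightarrow> nat" where
  "left_end s r =
    (if r = 4 * s + 2 then 4 * s + 3
     else if even r then 2 * s + 1 - r div 2
     else if r = 4 * s + 1 then 2 * s + 1
     else if r = 2 * s + 1 then 4 * s + 2
     else if r = 1 then 7 * s + 3
     else if r > 2 * s + 1 then 4 * s + 3 + (4 * s + 1 - r) div 2
     else 5 * s + 2 + (2 * s + 1 - r) div 2)"

lemma right_end_bounds:
  assumes "r \<in> {1..4 * s + 2}"
  shows "left_end s r + r \<in> {2 * s + 2..8 * s + 5}"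
proof (cases "even r")
  case True
  then obtain q where "r = 2 * q" ..
  then show ?thesis using assms by (auto simp: left_end_def)
next
  case False
  then obtain q where "r = 2 * q + 1" ..
  then show ?thesis using assms by (auto simp: left_end_def)
qed

lemma hooked_skolem_cover:
  assumes "p \<in> {1..8 * s + 3}"
  shows "\<exists>r\<in>{1..4 * s + 2}. p = left_end s r \<or> p = left_end s r + r"
proof -
  have left: ?thesis if "r \<in> {1..4 * s + 2}" "p = left_end s r" for r using that by blast
  have right: ?thesis if "r \<in> {1..4 * s + 2}" "p = left_end s r + r" for r using that by blast
  consider "p \<le> 2 * s" | "p = 2 * s + 1" | "2 * s + 2 \<le> p" "p \<le> 4 * s + 1"
    | "p = 4 * s + 2" "s > 0" | "p = 4 * s + 2" "s = 0" | "p = 4 * s + 3"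
    | "4 * s + 4 \<le> p" "p \<le> 5 * s + 2" | "5 * s + 3 \<le> p" "p \<le> 6 * s + 1"
    | "p = 6 * s + 2" | "p = 6 * s + 3" "s > 0" | "6 * s + 4 \<le> p" "p \<le> 7 * s + 2"
    | "p = 7 * s + 3" "s > 0" | "p = 7 * s + 4" "s > 0" | "7 * s + 5 \<le> p" "p \<le> 8 * s + 3"
  proof -
    consider "p < 4 * s + 2" | "p = 4 * s + 2" | "p = 4 * s + 3" | "4 * s + 4 \<le> p" "p < 6 * s + 2"
      | "p = 6 * s + 2" | "p = 6 * s + 3" | "6 * s + 4 \<le> p" by linarith
    then show thesis
    proof cases
      case 1
      then show thesis using that by (cases "p < 2 * s + 1"; cases "p = 2 * s + 1") auto
    next
      case 4
      then show thesis using that by (cases "p < 5 * s + 3") auto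
    next
      case 6
      then show thesis using that by (cases "s = 0") auto
    next
      case 7
      then show thesis using that assms by (cases "p < 7 * s + 3"; cases "p = 7 * s + 3"; cases "p = 7 * s + 4")
          auto
    qed (use that in auto)
  qed
  then show ?thesis
  proof cases
    case 1
    then show ?thesis using assms
      by (intro left[of "2 * (2 * s + 1 - p)"]) (auto simp: left_end_def)
  next
    case 2
    then show ?thesis by (intro left[of "4 * s + 1"]) (auto simp: left_end_def)
  next
    case 3
    then show ?thesis
      by (intro right[of "2 * (p - 2 * s - 1)"]) (auto simp: left_end_def)
  next
    case 4
    then show ?thesis by (intro left[of "2 * s + 1"]) (auto simp: left_end_def)
  next
    case 5
    then show ?thesis by (intro right[of 1]) (auto simp: left_end_def)
  next
    case 6
    then show ?thesis by (intro left[of "4 * s + 2"]) (auto simp: left_end_def)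
  next
    case 7
    define i where "i = p - 4 * s - 3"
    have "p = 4 * s + 3 + i" "1 \<le> i" "i < s" using 7 by (auto simp: i_def)
    then show ?thesis
      by (intro left[of "2 * (2 * s - i) + 1"]) (auto simp: left_end_def)
  next
    case 8
    define i where "i = p - 5 * s - 2"
    have "p = 5 * s + 2 + i" "1 \<le> i" "i < s" using 8 by (auto simp: i_def)
    then show ?thesis
      by (intro left[of "2 * (s - i) + 1"]) (auto simp: left_end_def)
  next
    case 9
    then show ?thesis by (intro right[of "4 * s + 1"]) (auto simp: left_end_def)
  next
    case 10
    then show ?thesis by (intro right[of "2 * s + 1"]) (auto simp: left_end_def)
  next
    case 11
    define i where "i = 7 * s + 3 - p"
    have "p = 7 * s + 3 - i" "1 \<le> i" "i < s" using 11 by (auto simp: i_def)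
    then show ?thesis
      by (intro right[of "2 * (s - i) + 1"]) (auto simp: left_end_def)
  next
    case 12
    then show ?thesis by (intro left[of 1]) (auto simp: left_end_def)
  next
    case 13
    then show ?thesis by (intro right[of 1]) (auto simp: left_end_def)
  next
    case 14
    define i where "i = 8 * s + 4 - p"
    have "p = 8 * s + 4 - i" "1 \<le> i" "i < s" using 14 by (auto simp: i_def)
    then show ?thesis
      by (intro right[of "2 * (2 * s - i) + 1"]) (auto simp: left_end_def)
  qed
qed

definition base_triple :: "nat \<Rightarrow> nat \<Rightarrow> nat \<Rightarrow> int" where
  "base_triple s r j = int ([0, left_end s r + 4 * s + 2, left_end s r + r + 4 * s + 2] ! j)"

text \<open>
  Shifting the ends by \<open>m = 4 * s + 2\<close> frees the differences \<open>1, \<dots>, m\<close> for the pairs themselves.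
  The ends below the hook give \<open>m + 1, \<dots>, 3 * m - 1\<close>, and the hook, the right end
  of the pair with \<open>r = m\<close>, gives \<open>3 * m + 1\<close>. The other nonzero residues, \<open>3 * m\<close> among them, are negatives of these.
\<close>

lemma base_triple_differences_cover:
  assumes n: "n = 24 * s + 13" and d: "d \<in> {1..<int n}"
  shows "\<exists>r\<in>{1..4 * s + 2}. \<exists>j<3. \<exists>k<3. j \<noteq> k \<and>
    (base_triple s r k - base_triple s r j) mod int n = d"
proof -
  define C where "C e \<longleftrightarrow> (\<exists>r\<in>{1..4 * s + 2}. \<exists>j<3. \<exists>k<3. j \<noteq> k \<and>
    (base_triple s r k - base_triple s r j) mod int n = e mod int n)" for e
  have CI: "C e" if "r \<in> {1..4 * s + 2}" "j < 3" "k < 3" "j \<noteq> k"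
    "base_triple s r k - base_triple s r j = e" for r j k e
    using that unfolding C_def by blast
  have C_uminus: "C (- e)" if "C e" for e
  proof -
    from that obtain r j k where *: "r \<in> {1..4 * s + 2}" "j < 3" "k < 3" "j \<noteq> k"
      "(base_triple s r k - base_triple s r j) mod int n = e mod int n"
      unfolding C_def by blast
    have "(base_triple s r j - base_triple s r k) mod int n = (- e) mod int n"
      using mod_minus_cong[OF *(5)] by simp
    then show ?thesis unfolding C_def using * by metis
  qed
  have C_cong: "C e" if "C e'" "e mod int n = e' mod int n" for e e'
    using that unfolding C_def by simp
  have small: "C (int e)" if e: "e \<in> {1..12 * s + 6}" for e
  proof -
    consider "e \<le> 4 * s + 2" | "4 * s + 3 \<le> e" "e \<le> 12 * s + 5" | "e = 12 * s + 6"
      using e by (cases "e < 4 * s + 3"; cases "e < 12 * s + 6") auto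
    then show ?thesis
    proof cases
      case 1
      then show ?thesis using e
        by (intro CI[of e 1 2]) (auto simp: base_triple_def)
    next
      case 2
      then have "e - (4 * s + 2) \<in> {1..8 * s + 3}" by auto
      then obtain r where r: "r \<in> {1..4 * s + 2}"
        and "e - (4 * s + 2) = left_end s r \<or> e - (4 * s + 2) = left_end s r + r"
        using hooked_skolem_cover by blast
      then consider "e = left_end s r + 4 * s + 2" | "e = left_end s r + r + 4 * s + 2"
        using 2 by linarith
      then show ?thesis
      proof cases
        case 1
        then show ?thesis using r by (intro CI[of r 0 1]) (auto simp: base_triple_def)
      next
        case 2
        then show ?thesis using r by (intro CI[of r 0 2]) (auto simp: base_triple_def)
      qed
    next
      case 3
      have "C (int (12 * s + 7))"
        by (rule CI[of "4 * s + 2" 0 2]) (auto simp: base_triple_def left_end_def)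
      moreover have "int e = - int (12 * s + 7) + int n" using 3 n by simp
      ultimately show ?thesis
        using C_uminus C_cong by (metis mod_add_self2)
    qed
  qed
  have "C d"
  proof (cases "d \<le> 12 * int s + 6")
    case True
    then have "C (int (nat d))" using d by (intro small) auto
    then show ?thesis using d by simp
  next
    case False
    then have "C (int (nat (int n - d)))" using d n by (intro small) auto
    then have "C (int n - d)" using d by simp
    from C_uminus[OF this] show ?thesis
      by (rule C_cong) (simp add: mod_eq_dvd_iff)
  qed
  then show ?thesis using d unfolding C_def by simp
qed

theorem theorem12:
  fixes m n :: nat
  assumes "m > 0" and "[m = 2] (mod 4)" and "n = 6 * m + 1"
  shows "\<exists>(V :: nat set) B xs. steiner_triple_system n V B \<and> sequencing V xs \<and>
           cyclic_good ((n + 3) div 4) B xs"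
proof -
  define s where "s = m div 4"
  have "m mod 4 = 2" using assms(2) by (simp add: cong_def)
  then have m: "m = 4 * s + 2" unfolding s_def by presburger
  have n: "n = 24 * s + 13" using m assms(3) by simp
  have l: "(n + 3) div 4 = 6 * s + 4" using n by simp
  define I where "I = {1..4 * s + 2}"
  define B where "B = {translate n (base_triple s r) z | r z. r \<in> I}"
  have "steiner_triple_system n {..<n} B"
    unfolding B_def
    by (rule steiner_triple_system_of_difference_cover)
      (use base_triple_differences_cover[OF n] in \<open>auto simp: I_def n\<close>)
  moreover have "cyclic_good (6 * s + 4) B [0..<n]"
    unfolding B_def
  proof (rule cyclic_good_translates)
    fix r assume "r \<in> I"
    then have "base_triple s r 2 - base_triple s r 0
        \<in> {int (6 * s + 4)..int n - int (6 * s + 4)}"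
      using right_end_bounds[of r s] by (simp add: I_def base_triple_def n)
    then show "\<exists>j<3. \<exists>k<3. base_triple s r k - base_triple s r j
        \<in> {int (6 * s + 4)..int n - int (6 * s + 4)}"
      by (intro exI[of _ 0] exI[of _ 2] conjI) auto
  qed
  moreover have "sequencing {..<n} [0..<n]"
    by (auto simp: sequencing_def)
  ultimately show ?thesis unfolding l by blast
qed

end
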